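(* Let $X$ be a locally compact Hausdorff space. Then the map $I:\mathcal{D}(X)\to\mathrm{Id_{gmp}^{ess}}(\mathrm{C}_{0}(X))$ induced by $$I(f,Y)=\{g\in\mathrm{C}_0(X) : g=0 \text{ on } X\setminus f(Y)\}$$ is (well defined and) bijective.
   Context: A discretization of $X$ is a pair $(f,Y)$ where $Y$ is a discrete space and $f:Y\to X$ is a homeomorphic embedding with dense range. Two discretizations $(f,Y)$, $(g,Z)$ are equivalent if there is a bijection $h:Y\to Z$ with $gh=f$. $\mathcal{D}(X)$ is the set of equivalence classes of discretizations of $X$ (possibly empty). $\mathrm{C}_0(X)$ is the C$^*$-algebra of continuous complex-valued functions on $X$ vanishing at infinity, with the uniform norm and involution $f^*(x)=\overline{f(x)}$. A projection is an element $p$ with $p=p^*=p^2$; projections are ordered by $p\le q$ iff $pq=p$. A minimal projection of an algebra is a nonzero projection in it which is minimal among its nonzero projections. A closed ideal $J$ of $\mathrm{C}_0(X)$ is generated by its minimal projections if $J$ is the smallest C$^*$-subalgebra (uniformly closed, involution-closed subalgebra, not necessarily unital) of $\mathrm{C}_0(X)$ containing all minimal projections of $J$ (the zero ideal satisfies this). $J$ is essential if $J\cap K\ne\{0\}$ for every nonzero closed ideal $K$ of $\mathrm{C}_0(X)$. $\mathrm{Id_{gmp}^{ess}}(\mathrm{C}_0(X))$ is the set of closed essential ideals of $\mathrm{C}_0(X)$ which are generated by their minimal projections. *)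

theory Defs
  imports "HOL-Analysis.Analysis" "HOL-Library.Equipollence"
begin

section \<open>Discretizations\<close>

text \<open>The points of \<open>Y\<close> live in a type \<open>'b\<close> that is independent of \<open>'a\<close>. The values of \<open>f\<close> outside
  \<open>topspace Y\<close> are irrelevant and are identified by the equivalence below.\<close>

definition discretizations :: "'a topology \<Rightarrow> (('b \<Rightarrow> 'a) \<times> 'b topology) set" where
  "discretizations X = {(f, Y). Y = discrete_topology (topspace Y) \<and> embedding_map Y X f \<and>
     X closure_of (f ` topspace Y) = topspace X}"

definition discretization_equiv ::
  "(('b \<Rightarrow> 'a) \<times> 'b topology) \<Rightarrow> (('c \<Rightarrow> 'a) \<times> 'c topology) \<Rightarrow> bool" where
  "discretization_equiv = (\<lambda>(f, Y) (g, Z).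
     \<exists>h. bij_betw h (topspace Y) (topspace Z) \<and> (\<forall>y\<in>topspace Y. g (h y) = f y))"

definition discretization_rel ::
  "'a topology \<Rightarrow> ((('b \<Rightarrow> 'a) \<times> 'b topology) \<times> (('b \<Rightarrow> 'a) \<times> 'b topology)) set" where
  "discretization_rel X =
     {(d, e). d \<in> discretizations X \<and> e \<in> discretizations X \<and> discretization_equiv d e}"

definition discretization_classes :: "'a topology \<Rightarrow> (('b \<Rightarrow> 'a) \<times> 'b topology) set set" where
  "discretization_classes X = discretizations X // discretization_rel X"

lemma equiv_discretization_rel:
  fixes X :: "'a topology"
  shows "equiv (discretizations X :: (('b \<Rightarrow> 'a) \<times> 'b topology) set) (discretization_rel X)"
proof (rule equivI)
  show "(discretization_rel X :: ((('b \<Rightarrow> 'a) \<times> 'b topology) \<times> _) set)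
          \<subseteq> discretizations X \<times> discretizations X"
    by (auto simp: discretization_rel_def)
  show "refl_on (discretizations X :: (('b \<Rightarrow> 'a) \<times> 'b topology) set) (discretization_rel X)"
  proof (rule refl_onI)
    fix d :: "('b \<Rightarrow> 'a) \<times> 'b topology" assume d: "d \<in> discretizations X"
    have "discretization_equiv d d"
      unfolding discretization_equiv_def by (auto intro!: exI[of _ id])
    with d show "(d, d) \<in> discretization_rel X" by (simp add: discretization_rel_def)
  qed
  show "sym (discretization_rel X :: ((('b \<Rightarrow> 'a) \<times> 'b topology) \<times> _) set)"
  proof (rule symI)
    fix d e :: "('b \<Rightarrow> 'a) \<times> 'b topology" assume de: "(d, e) \<in> discretization_rel X"
    obtain f Y g Z where d: "d = (f, Y)" and e: "e = (g, Z)" by (cases d, cases e)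
    from de obtain h where h: "bij_betw h (topspace Y) (topspace Z)" "\<forall>y\<in>topspace Y. g (h y) = f y"
      by (auto simp: discretization_rel_def discretization_equiv_def d e)
    have "bij_betw (inv_into (topspace Y) h) (topspace Z) (topspace Y)"
      using h(1) by (rule bij_betw_inv_into)
    moreover have "f (inv_into (topspace Y) h z) = g z" if "z \<in> topspace Z" for z
      using that h by (metis bij_betw_inv_into_right bij_betw_def inv_into_into)
    ultimately have "discretization_equiv e d"
      by (auto simp: discretization_equiv_def d e)
    with de show "(e, d) \<in> discretization_rel X" by (simp add: discretization_rel_def)
  qed
  show "trans (discretization_rel X :: ((('b \<Rightarrow> 'a) \<times> 'b topology) \<times> _) set)"
  proof (rule transI)
    fix d e k :: "('b \<Rightarrow> 'a) \<times> 'b topology"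
    assume de: "(d, e) \<in> discretization_rel X" and ek: "(e, k) \<in> discretization_rel X"
    obtain f Y g Z u W where d: "d = (f, Y)" and e: "e = (g, Z)" and k: "k = (u, W)"
      by (cases d, cases e, cases k)
    from de obtain h where h: "bij_betw h (topspace Y) (topspace Z)" "\<forall>y\<in>topspace Y. g (h y) = f y"
      by (auto simp: discretization_rel_def discretization_equiv_def d e)
    from ek obtain j where j: "bij_betw j (topspace Z) (topspace W)" "\<forall>y\<in>topspace Z. u (j y) = g y"
      by (auto simp: discretization_rel_def discretization_equiv_def e k)
    have "bij_betw (j \<circ> h) (topspace Y) (topspace W)" using h j by (blast intro: bij_betw_trans)
    moreover have "\<forall>y\<in>topspace Y. u ((j \<circ> h) y) = f y" using h j by (metis bij_betwE comp_apply)
    ultimately have "discretization_equiv d k"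
      unfolding discretization_equiv_def d k by blast
    with de ek show "(d, k) \<in> discretization_rel X" by (simp add: discretization_rel_def)
  qed
qed

text \<open>Up to equivalence, discretizations on arbitrary types \<open>'c\<close> are all found on any one
  type \<open>'b\<close> that has at least as many elements as \<open>X\<close> has points; for such \<open>'b\<close> (for instance
  \<open>'a\<close> itself), \<open>discretization_classes X\<close> is therefore the set of all equivalence classes.\<close>

lemma ex_equivalent_discretization:
  fixes X :: "'a topology" and f :: "'c \<Rightarrow> 'a"
  assumes large: "topspace X \<lesssim> (UNIV :: 'b set)" and d: "(f, Y) \<in> discretizations X"
  shows "\<exists>e :: ('b \<Rightarrow> 'a) \<times> 'b topology. e \<in> discretizations X \<and> discretization_equiv (f, Y) e"
proof -
  from large obtain j :: "'a \<Rightarrow> 'b" where j: "inj_on j (topspace X)" by (auto simp: lepoll_def)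
  have Y: "Y = discrete_topology (topspace Y)" and emb: "embedding_map Y X f"
    and dense: "X closure_of (f ` topspace Y) = topspace X"
    using d by (auto simp: discretizations_def)
  have f_inj: "inj_on f (topspace Y)" and f_sub: "f ` topspace Y \<subseteq> topspace X"
    using emb by (auto simp: embedding_map_def homeomorphic_map_def quotient_map_def)
  define h where "h = j \<circ> f"
  define S where "S = h ` topspace Y"
  define Z where "Z = discrete_topology S"
  define r where "r = inv_into (topspace Y) h"
  have h_inj: "inj_on h (topspace Y)"
    unfolding h_def using f_inj f_sub j by (blast intro: comp_inj_on inj_on_subset)
  have h_bij: "bij_betw h (topspace Y) (topspace Z)"
    using h_inj by (auto simp: bij_betw_def Z_def S_def)
  have r_bij: "bij_betw r (topspace Z) (topspace Y)"
    unfolding r_def by (rule bij_betw_inv_into[OF h_bij])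
  have img: "(f \<circ> r) ` topspace Z = f ` topspace Y"
    using r_bij by (metis bij_betw_def image_comp)
  have "homeomorphic_map Z Y r"
  proof -
    have "homeomorphic_map (discrete_topology (topspace Z)) (discrete_topology (topspace Y)) r"
    proof (rule bijective_open_imp_homeomorphic_map)
      show "open_map (discrete_topology (topspace Z)) (discrete_topology (topspace Y)) r"
        using r_bij by (auto simp: open_map_def bij_betw_def)
    qed (use r_bij in \<open>auto simp: bij_betw_def\<close>)
    then show ?thesis using Y by (simp add: Z_def)
  qed
  then have "embedding_map Z X (f \<circ> r)"
    using emb by (meson embedding_map_compose surjective_embedding_map)
  then have "(f \<circ> r, Z) \<in> discretizations X"
    unfolding discretizations_def using img dense by (simp add: Z_def)
  moreover have "discretization_equiv (f, Y) (f \<circ> r, Z)"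
    unfolding discretization_equiv_def using h_bij h_inj by (auto simp: r_def intro!: exI[of _ h])
  ultimately show ?thesis by blast
qed

section \<open>The C*-algebra of continuous functions vanishing at infinity\<close>

text \<open>As in \<^const>\<open>cfunspace\<close>, functions on \<open>X\<close> are normalised to be \<^const>\<open>undefined\<close> outside
  \<open>topspace X\<close>, so that equality in \<open>C0 X\<close> is equality on \<open>topspace X\<close>.\<close>

definition C0 :: "'a topology \<Rightarrow> ('a \<Rightarrow> complex) set" where
  "C0 X = {f \<in> extensional (topspace X). continuous_map X euclidean f \<and>
     (\<forall>\<epsilon>>0. \<exists>K. compactin X K \<and> (\<forall>x \<in> topspace X - K. cmod (f x) < \<epsilon>))}"

definition C0_zero :: "'a topology \<Rightarrow> 'a \<Rightarrow> complex" where
  "C0_zero X = (\<lambda>x\<in>topspace X. 0)"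

definition C0_add :: "'a topology \<Rightarrow> ('a \<Rightarrow> complex) \<Rightarrow> ('a \<Rightarrow> complex) \<Rightarrow> 'a \<Rightarrow> complex" where
  "C0_add X f g = (\<lambda>x\<in>topspace X. f x + g x)"

definition C0_scale :: "'a topology \<Rightarrow> complex \<Rightarrow> ('a \<Rightarrow> complex) \<Rightarrow> 'a \<Rightarrow> complex" where
  "C0_scale X c f = (\<lambda>x\<in>topspace X. c * f x)"

definition C0_mult :: "'a topology \<Rightarrow> ('a \<Rightarrow> complex) \<Rightarrow> ('a \<Rightarrow> complex) \<Rightarrow> 'a \<Rightarrow> complex" where
  "C0_mult X f g = (\<lambda>x\<in>topspace X. f x * g x)"

definition C0_star :: "'a topology \<Rightarrow> ('a \<Rightarrow> complex) \<Rightarrow> 'a \<Rightarrow> complex" where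
  "C0_star X f = (\<lambda>x\<in>topspace X. cnj (f x))"

text \<open>The distance of \<^const>\<open>cfunspace\<close> is the supremum distance on bounded continuous functions;
  it is the metric of the uniform norm on the subset \<open>C0 X\<close>.\<close>

lemma C0_subset_cfunspace: "C0 X \<subseteq> mspace (cfunspace X euclidean_metric)"
proof
  fix f assume f: "f \<in> C0 X"
  then have cont: "continuous_map X euclidean f" by (simp add: C0_def)
  from f have "\<forall>\<epsilon>>0. \<exists>K. compactin X K \<and> (\<forall>x \<in> topspace X - K. cmod (f x) < \<epsilon>)"
    by (simp add: C0_def)
  then obtain K where K: "compactin X K" "\<forall>x \<in> topspace X - K. cmod (f x) < 1"
    using zero_less_one by blast
  have "compact (f ` K)"
    using image_compactin[OF K(1) cont] by simp
  then have "bounded (f ` K)" by (rule compact_imp_bounded)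
  moreover have "bounded (f ` (topspace X - K))"
    using K(2) by (auto intro!: boundedI[of _ 1] less_imp_le)
  ultimately have "bounded (f ` K \<union> f ` (topspace X - K))" by simp
  then have "bounded (f ` topspace X)" by (rule bounded_subset) auto
  with f cont show "f \<in> mspace (cfunspace X euclidean_metric)"
    by (simp add: C0_def)
qed

definition uniformly_closed :: "'a topology \<Rightarrow> ('a \<Rightarrow> complex) set \<Rightarrow> bool" where
  "uniformly_closed X A \<longleftrightarrow>
     closedin (subtopology (mtopology_of (cfunspace X euclidean_metric)) (C0 X)) A"

definition C0_subspace :: "'a topology \<Rightarrow> ('a \<Rightarrow> complex) set \<Rightarrow> bool" where
  "C0_subspace X A \<longleftrightarrow> A \<subseteq> C0 X \<and> C0_zero X \<in> A \<and>
     (\<forall>f\<in>A. \<forall>g\<in>A. C0_add X f g \<in> A) \<and> (\<forall>c. \<forall>f\<in>A. C0_scale X c f \<in> A)"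

definition cstar_subalgebra :: "'a topology \<Rightarrow> ('a \<Rightarrow> complex) set \<Rightarrow> bool" where
  "cstar_subalgebra X A \<longleftrightarrow> C0_subspace X A \<and> (\<forall>f\<in>A. \<forall>g\<in>A. C0_mult X f g \<in> A) \<and>
     (\<forall>f\<in>A. C0_star X f \<in> A) \<and> uniformly_closed X A"

text \<open>One-sided multiplication suffices since \<open>C0 X\<close> is commutative.\<close>

definition closed_ideal :: "'a topology \<Rightarrow> ('a \<Rightarrow> complex) set \<Rightarrow> bool" where
  "closed_ideal X J \<longleftrightarrow> C0_subspace X J \<and> (\<forall>f\<in>C0 X. \<forall>g\<in>J. C0_mult X f g \<in> J) \<and>
     uniformly_closed X J"

definition projections :: "'a topology \<Rightarrow> ('a \<Rightarrow> complex) set" where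
  "projections X = {p \<in> C0 X. p = C0_star X p \<and> p = C0_mult X p p}"

definition projection_le :: "'a topology \<Rightarrow> ('a \<Rightarrow> complex) \<Rightarrow> ('a \<Rightarrow> complex) \<Rightarrow> bool" where
  "projection_le X p q \<longleftrightarrow> C0_mult X p q = p"

definition minimal_projections :: "'a topology \<Rightarrow> ('a \<Rightarrow> complex) set \<Rightarrow> ('a \<Rightarrow> complex) set" where
  "minimal_projections X J = {p \<in> projections X \<inter> J. p \<noteq> C0_zero X \<and>
     (\<forall>q \<in> projections X \<inter> J. q \<noteq> C0_zero X \<and> projection_le X q p \<longrightarrow> q = p)}"

definition generated_by_minimal_projections :: "'a topology \<Rightarrow> ('a \<Rightarrow> complex) set \<Rightarrow> bool" where
  "generated_by_minimal_projections X J \<longleftrightarrow>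
     J = cstar_subalgebra X hull minimal_projections X J"

definition essential_ideal :: "'a topology \<Rightarrow> ('a \<Rightarrow> complex) set \<Rightarrow> bool" where
  "essential_ideal X J \<longleftrightarrow>
     (\<forall>K. closed_ideal X K \<and> K \<noteq> {C0_zero X} \<longrightarrow> J \<inter> K \<noteq> {C0_zero X})"

definition Id_gmp_ess :: "'a topology \<Rightarrow> ('a \<Rightarrow> complex) set set" where
  "Id_gmp_ess X =
     {J. closed_ideal X J \<and> essential_ideal X J \<and> generated_by_minimal_projections X J}"

section \<open>The ideal of a discretization\<close>

definition discretization_ideal ::
  "'a topology \<Rightarrow> ('b \<Rightarrow> 'a) \<times> 'b topology \<Rightarrow> ('a \<Rightarrow> complex) set" where
  "discretization_ideal X = (\<lambda>(f, Y). {g \<in> C0 X. \<forall>x \<in> topspace X - f ` topspace Y. g x = 0})"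

text \<open>The map induced on equivalence classes: the common value of \<open>discretization_ideal X\<close> on
  the members of the class. It is meaningful once \<open>discretization_ideal X\<close> respects
  \<open>discretization_rel X\<close>.\<close>

definition induced_ideal_map ::
  "'a topology \<Rightarrow> (('b \<Rightarrow> 'a) \<times> 'b topology) set \<Rightarrow> ('a \<Rightarrow> complex) set" where
  "induced_ideal_map X C = the_elem (discretization_ideal X ` C)"

end

theory Submission
  imports Defs
begin

text \<open>In a Hausdorff space a dense subset that is discrete in the subspace topology consists of
  isolated points of the whole space, and conversely a dense subset contains every isolated point.
  Hence all discretizations have the same range, the set \<open>D\<close> of isolated points, and there is at
  most one equivalence class; it exists iff \<open>D\<close> is dense. On the algebra side, let \<open>p\<close> be a minimal
  projection of a closed ideal \<open>J\<close> that is generated by its minimal projections. Two different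
  minimal projections are orthogonal, so all elements of \<open>J\<close> are constant on the support of \<open>p\<close>;
  since \<open>f p\<close> lies in \<open>J\<close> for each \<open>f\<close> in the algebra, Urysohn's lemma forces the support to be a
  single isolated point. If \<open>J\<close> is moreover essential, it meets the ideal of functions supported on
  any given nonempty open set, so \<open>D\<close> is dense and \<open>J\<close> contains the indicators of all isolated
  points, that is, \<open>J\<close> is the ideal of functions vanishing off \<open>D\<close>.\<close>

section \<open>The algebra of functions vanishing at infinity\<close>

lemma C0D:
  assumes "f \<in> C0 X"
  shows "f \<in> extensional (topspace X)" "continuous_map X euclidean f"
    "\<epsilon> > 0 \<Longrightarrow> \<exists>K. compactin X K \<and> (\<forall>x \<in> topspace X - K. cmod (f x) < \<epsilon>)"
  using assms by (auto simp: C0_def)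

lemma C0_eqI:
  assumes "f \<in> C0 X" "g \<in> C0 X" "\<And>x. x \<in> topspace X \<Longrightarrow> f x = g x"
  shows "f = g"
  using assms by (meson C0D(1) extensionalityI)

lemma C0_restrictI:
  assumes "continuous_map X euclidean f"
    and "\<And>\<epsilon>. \<epsilon> > 0 \<Longrightarrow> \<exists>K. compactin X K \<and> (\<forall>x \<in> topspace X - K. cmod (f x) < \<epsilon>)"
  shows "restrict f (topspace X) \<in> C0 X"
proof -
  have "continuous_map X euclidean (restrict f (topspace X))"
    using assms(1) by (rule continuous_map_eq) simp
  moreover have "\<exists>K. compactin X K \<and> (\<forall>x \<in> topspace X - K. cmod (restrict f (topspace X) x) < \<epsilon>)"
    if "\<epsilon> > 0" for \<epsilon>
    using assms(2)[OF that] by auto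
  ultimately show ?thesis
    by (simp add: C0_def)
qed

lemma C0_zero_in_C0: "C0_zero X \<in> C0 X"
  unfolding C0_zero_def by (rule C0_restrictI) (auto intro: exI[of _ "{}"])

lemma C0_add_in_C0:
  assumes f: "f \<in> C0 X" and g: "g \<in> C0 X"
  shows "C0_add X f g \<in> C0 X"
  unfolding C0_add_def
proof (rule C0_restrictI)
  show "continuous_map X euclidean (\<lambda>x. f x + g x)"
    using C0D(2)[OF f] C0D(2)[OF g] by (rule continuous_map_add)
  fix \<epsilon> :: real assume "\<epsilon> > 0"
  then obtain K L where K: "compactin X K" "\<forall>x \<in> topspace X - K. cmod (f x) < \<epsilon>/2"
    and L: "compactin X L" "\<forall>x \<in> topspace X - L. cmod (g x) < \<epsilon>/2"
    using C0D(3)[OF f, of "\<epsilon>/2"] C0D(3)[OF g, of "\<epsilon>/2"] by auto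
  have "cmod (f x + g x) < \<epsilon>" if "x \<in> topspace X - (K \<union> L)" for x
  proof -
    have "cmod (f x) < \<epsilon>/2" "cmod (g x) < \<epsilon>/2" using K L that by auto
    then show ?thesis using norm_triangle_ineq[of "f x" "g x"] by linarith
  qed
  then show "\<exists>K. compactin X K \<and> (\<forall>x \<in> topspace X - K. cmod (f x + g x) < \<epsilon>)"
    using compactin_Un[OF K(1) L(1)] by blast
qed

lemma C0_scale_in_C0:
  assumes f: "f \<in> C0 X"
  shows "C0_scale X c f \<in> C0 X"
  unfolding C0_scale_def
proof (rule C0_restrictI)
  show "continuous_map X euclidean (\<lambda>x. c * f x)"
    using continuous_map_compose[OF C0D(2)[OF f], of euclidean "\<lambda>z. c * z"]
    by (simp add: o_def continuous_on_mult_left)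
  fix \<epsilon> :: real assume \<epsilon>: "\<epsilon> > 0"
  \<comment> \<open>Adding 1 keeps the divisor positive when c is 0.\<close>
  have pos: "cmod c + 1 > 0" by (simp add: add_nonneg_pos)
  with \<epsilon> obtain K where K: "compactin X K" "\<forall>x \<in> topspace X - K. cmod (f x) < \<epsilon> / (cmod c + 1)"
    using C0D(3)[OF f, of "\<epsilon> / (cmod c + 1)"] by auto
  have "cmod (c * f x) < \<epsilon>" if "x \<in> topspace X - K" for x
  proof -
    have "cmod (c * f x) \<le> (cmod c + 1) * cmod (f x)"
      by (simp add: norm_mult algebra_simps)
    also have "\<dots> < \<epsilon>"
      using K(2) that pos by (simp add: pos_less_divide_eq mult.commute)
    finally show ?thesis .
  qed
  with K(1) show "\<exists>K. compactin X K \<and> (\<forall>x \<in> topspace X - K. cmod (c * f x) < \<epsilon>)"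
    by blast
qed

lemma C0_mult_in_C0:
  assumes f: "f \<in> C0 X" and g: "g \<in> C0 X"
  shows "C0_mult X f g \<in> C0 X"
  unfolding C0_mult_def
proof (rule C0_restrictI)
  show "continuous_map X euclidean (\<lambda>x. f x * g x)"
    using C0D(2)[OF f] C0D(2)[OF g] by (simp add: continuous_map_atin tendsto_mult)
  fix \<epsilon> :: real assume "\<epsilon> > 0"
  then obtain K L where K: "compactin X K" "\<forall>x \<in> topspace X - K. cmod (f x) < \<epsilon>"
    and L: "compactin X L" "\<forall>x \<in> topspace X - L. cmod (g x) < 1"
    using C0D(3)[OF f] C0D(3)[OF g] zero_less_one by metis
  have "cmod (f x * g x) < \<epsilon>" if "x \<in> topspace X - (K \<union> L)" for x
    using K(2) L(2) that mult_strict_mono'[of "cmod (f x)" \<epsilon> "cmod (g x)" 1]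
    by (simp add: norm_mult)
  then show "\<exists>K. compactin X K \<and> (\<forall>x \<in> topspace X - K. cmod (f x * g x) < \<epsilon>)"
    using compactin_Un[OF K(1) L(1)] by blast
qed

lemma C0_star_in_C0:
  assumes f: "f \<in> C0 X"
  shows "C0_star X f \<in> C0 X"
  unfolding C0_star_def
proof (rule C0_restrictI)
  show "continuous_map X euclidean (\<lambda>x. cnj (f x))"
    using continuous_map_compose[OF C0D(2)[OF f], of euclidean cnj]
    by (simp add: o_def continuous_on_cnj)
qed (use C0D(3)[OF f] in auto)

lemmas C0_closed = C0_zero_in_C0 C0_add_in_C0 C0_scale_in_C0 C0_mult_in_C0 C0_star_in_C0

lemmas C0_ops_def = C0_zero_def C0_add_def C0_scale_def C0_mult_def C0_star_def

section \<open>Uniform distance and uniform closedness in pointwise terms\<close>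

lemma mdist_C0_le:
  assumes "f \<in> C0 X" "g \<in> C0 X" "\<epsilon> \<ge> 0"
  shows "mdist (cfunspace X euclidean_metric) f g \<le> \<epsilon> \<longleftrightarrow>
    (\<forall>x\<in>topspace X. cmod (f x - g x) \<le> \<epsilon>)"
\<comment> \<open>On the empty space f and g coincide, so the distance is 0 and both sides hold
  because \<epsilon> is nonnegative.\<close>
proof (cases "topspace X = {}")
  case True
  then have "f = g" using assms C0_eqI by blast
  with assms True show ?thesis
    using C0_subset_cfunspace by (metis empty_iff mdist_zero subsetD)
next
  case False
  then show ?thesis
    using cfunspace_mdist_le[of f X euclidean_metric g \<epsilon>] assms C0_subset_cfunspace
    by (auto simp: dist_norm)
qed

text \<open>Removes the metric from all later arguments. Closure is tested with closed balls,
  because a non-strict bound on the supremum is the same as a pointwise bound.\<close>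

lemma uniformly_closed_iff:
  assumes A: "A \<subseteq> C0 X"
  shows "uniformly_closed X A \<longleftrightarrow>
    (\<forall>g\<in>C0 X. (\<forall>\<epsilon>>0. \<exists>a\<in>A. \<forall>x\<in>topspace X. cmod (g x - a x) \<le> \<epsilon>) \<longrightarrow> g \<in> A)"
proof -
  let ?m = "cfunspace X (euclidean_metric :: complex metric)"
  interpret M: Metric_space "mspace ?m" "mdist ?m"
    by (rule Metric_space_mspace_mdist)
  have sub: "C0 X \<subseteq> mspace ?m" by (rule C0_subset_cfunspace)
  have near: "g \<in> mtopology_of ?m closure_of A \<longleftrightarrow>
      (\<forall>\<epsilon>>0. \<exists>a\<in>A. \<forall>x\<in>topspace X. cmod (g x - a x) \<le> \<epsilon>)" if g: "g \<in> C0 X" for g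
  proof -
    have "a \<in> M.mcball g \<epsilon> \<longleftrightarrow> (\<forall>x\<in>topspace X. cmod (g x - a x) \<le> \<epsilon>)"
      if "a \<in> A" "\<epsilon> > 0" for a \<epsilon>
      using mdist_C0_le[OF g, of a \<epsilon>] that A g sub by (auto simp del: mspace_cfunspace)
    then show ?thesis
      unfolding mtopology_of_def M.metric_closure_of_alt using g sub by blast
  qed
  have "A \<subseteq> mtopology_of ?m closure_of A"
    using A sub by (intro closure_of_subset) (simp del: mspace_cfunspace)
  then show ?thesis
    unfolding uniformly_closed_def closedin_Int_closure_of using near A by blast
qed

section \<open>Functions vanishing off a set\<close>

text \<open>\<open>discretization_ideal\<close> seen as a function of the range alone. For open S it
  also supplies the ideal of functions supported in S, against which essentiality is tested.\<close>

definition vanishing_ideal :: "'a topology \<Rightarrow> 'a set \<Rightarrow> ('a \<Rightarrow> complex) set" where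
  "vanishing_ideal X S = {g \<in> C0 X. \<forall>x \<in> topspace X - S. g x = 0}"

text \<open>Lets pointwise equations pass to uniform limits. If z and w differed, a common
  approximation within a third of their distance would violate the triangle inequality.\<close>

lemma pointwise_limit_eq:
  fixes z w :: complex
  assumes "\<And>\<epsilon>. \<epsilon> > 0 \<Longrightarrow> \<exists>a. cmod (z - a) \<le> \<epsilon> \<and> cmod (w - a) \<le> \<epsilon>"
  shows "z = w"
proof (rule ccontr)
  assume "z \<noteq> w"
  then obtain a where "cmod (z - a) \<le> cmod (z - w) / 3" "cmod (w - a) \<le> cmod (z - w) / 3"
    using assms[of "cmod (z - w) / 3"] by auto
  moreover have "cmod (z - w) \<le> cmod (z - a) + cmod (w - a)"
    using norm_triangle_ineq4[of "z - a" "w - a"] by simp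
  moreover have "cmod (z - w) > 0" using \<open>z \<noteq> w\<close> by simp
  ultimately show False by linarith
qed

lemma vanishing_ideal_subspace: "C0_subspace X (vanishing_ideal X S)"
  by (auto simp: C0_subspace_def vanishing_ideal_def C0_closed)
    (auto simp: C0_ops_def)

lemma vanishing_ideal_uniformly_closed: "uniformly_closed X (vanishing_ideal X S)"
proof -
  have "g x = 0"
    if "\<forall>\<epsilon>>0. \<exists>a\<in>vanishing_ideal X S. \<forall>x\<in>topspace X. cmod (g x - a x) \<le> \<epsilon>"
      and x: "x \<in> topspace X - S" for g x
  proof (rule pointwise_limit_eq)
    fix \<epsilon> :: real assume "\<epsilon> > 0"
    with that(1) obtain a where a: "a \<in> vanishing_ideal X S"
        "\<forall>x\<in>topspace X. cmod (g x - a x) \<le> \<epsilon>"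
      by meson
    \<comment> \<open>Since the approximant vanishes at x, the number 0 approximates both
      \<open>g x\<close> and 0.\<close>
    then have "a x = 0" "cmod (g x - a x) \<le> \<epsilon>" using x by (auto simp: vanishing_ideal_def)
    with \<open>\<epsilon> > 0\<close> show "\<exists>a. cmod (g x - a) \<le> \<epsilon> \<and> cmod (0 - a) \<le> \<epsilon>"
      by (intro exI[of _ 0]) simp
  qed
  moreover have "vanishing_ideal X S \<subseteq> C0 X"
    by (auto simp: vanishing_ideal_def)
  ultimately show ?thesis
    by (simp add: uniformly_closed_iff) (simp add: vanishing_ideal_def)
qed

lemma vanishing_ideal_mult:
  assumes "f \<in> C0 X" "g \<in> vanishing_ideal X S"
  shows "C0_mult X f g \<in> vanishing_ideal X S"
  using assms C0_mult_in_C0[of f X g] by (simp add: vanishing_ideal_def C0_mult_def)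

lemma vanishing_ideal_star:
  assumes "g \<in> vanishing_ideal X S"
  shows "C0_star X g \<in> vanishing_ideal X S"
  using assms C0_star_in_C0[of g X] by (simp add: vanishing_ideal_def C0_star_def)

lemma vanishing_ideal_closed_ideal: "closed_ideal X (vanishing_ideal X S)"
  by (simp add: closed_ideal_def vanishing_ideal_subspace vanishing_ideal_uniformly_closed
      vanishing_ideal_mult)

lemma vanishing_ideal_cstar_subalgebra: "cstar_subalgebra X (vanishing_ideal X S)"
proof -
  have "f \<in> C0 X" if "f \<in> vanishing_ideal X S" for f
    using that by (simp add: vanishing_ideal_def)
  then show ?thesis
    by (simp add: cstar_subalgebra_def vanishing_ideal_subspace vanishing_ideal_uniformly_closed
        vanishing_ideal_mult vanishing_ideal_star)
qed

text \<open>Carries an equality of values at two points from a generating set to everything it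
  generates.\<close>

lemma equalizer_cstar_subalgebra:
  assumes x: "x \<in> topspace X" and y: "y \<in> topspace X"
  shows "cstar_subalgebra X {f \<in> C0 X. f x = f y}"
proof -
  have "g x = g y"
    if "\<forall>\<epsilon>>0. \<exists>a\<in>{f \<in> C0 X. f x = f y}. \<forall>x\<in>topspace X. cmod (g x - a x) \<le> \<epsilon>" for g
  proof (rule pointwise_limit_eq)
    fix \<epsilon> :: real assume "\<epsilon> > 0"
    with that obtain a where "a x = a y" "\<forall>x\<in>topspace X. cmod (g x - a x) \<le> \<epsilon>"
      by blast
    with x y show "\<exists>a. cmod (g x - a) \<le> \<epsilon> \<and> cmod (g y - a) \<le> \<epsilon>" by metis
  qed
  then have "uniformly_closed X {f \<in> C0 X. f x = f y}"
    by (subst uniformly_closed_iff) auto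
  with x y show ?thesis
    by (auto simp: cstar_subalgebra_def C0_subspace_def C0_closed) (auto simp: C0_ops_def)
qed

section \<open>Indicators of isolated points\<close>

definition isolated_points :: "'a topology \<Rightarrow> 'a set" where
  "isolated_points X = {x. openin X {x}}"

lemma isolated_points_subset: "isolated_points X \<subseteq> topspace X"
  by (auto simp: isolated_points_def dest: openin_subset)

definition point_indicator :: "'a topology \<Rightarrow> 'a \<Rightarrow> 'a \<Rightarrow> complex" where
  "point_indicator X d = (\<lambda>x\<in>topspace X. if x = d then 1 else 0)"

lemma point_indicator_in_C0:
  assumes "Hausdorff_space X" "d \<in> isolated_points X"
  shows "point_indicator X d \<in> C0 X"
  unfolding point_indicator_def
proof (rule C0_restrictI)
  have d: "openin X {d}" "d \<in> topspace X"
    using assms(2) isolated_points_subset[of X] by (auto simp: isolated_points_def)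
  then have co: "openin X (topspace X - {d})"
    using assms(1) by (simp add: closedin_Hausdorff_sing_eq openin_diff)
  \<comment> \<open>The preimage of any set under a function with values 0 and 1 is assembled from
    \<open>{d}\<close> and its complement, both of which are open.\<close>
  have "openin X {x \<in> topspace X. (if x = d then 1 else 0::complex) \<in> U}" for U
  proof -
    have "{x \<in> topspace X. (if x = d then 1 else 0::complex) \<in> U} =
       (if 1 \<in> U then {d} else {}) \<union> (if 0 \<in> U then topspace X - {d} else {})"
      using d by auto
    with d co show ?thesis by (simp add: openin_Un)
  qed
  then show "continuous_map X euclidean (\<lambda>x. if x = d then 1 else 0::complex)"
    by (simp add: continuous_map_def)
  show "\<exists>K. compactin X K \<and> (\<forall>x \<in> topspace X - K. cmod (if x = d then 1 else 0) < \<epsilon>)"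
    if "\<epsilon> > 0" for \<epsilon> :: real
    using that d by (intro exI[of _ "{d}"]) auto
qed

section \<open>Point indicators as minimal projections, and their closed span\<close>

lemma projectionsD:
  assumes "p \<in> projections X"
  shows "p \<in> C0 X" "C0_star X p = p" "C0_mult X p p = p"
  using assms by (simp_all add: projections_def)

lemma minimal_projectionsD:
  assumes "p \<in> minimal_projections X J"
  shows "p \<in> projections X" "p \<in> J" "p \<noteq> C0_zero X"
  using assms by (simp_all add: minimal_projections_def)

lemma nonzero_in_C0:
  assumes "f \<in> C0 X" "f \<noteq> C0_zero X"
  obtains x where "x \<in> topspace X" "f x \<noteq> 0"
proof -
  have "C0_zero X x = 0" if "x \<in> topspace X" for x
    using that by (simp add: C0_zero_def)
  with that show thesis
    using C0_eqI[OF assms(1) C0_zero_in_C0] assms(2) by metis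
qed

text \<open>A projection below the indicator vanishes off d, and its value at d is an idempotent
  complex number; unless the projection is zero, that value is 1.\<close>

lemma point_indicator_minimal_projection:
  assumes X: "Hausdorff_space X" and d: "d \<in> isolated_points X" and J: "point_indicator X d \<in> J"
  shows "point_indicator X d \<in> minimal_projections X J"
proof -
  have dX: "d \<in> topspace X" using d isolated_points_subset[of X] by auto
  have p: "point_indicator X d \<in> C0 X" using X d by (rule point_indicator_in_C0)
  have "point_indicator X d \<noteq> C0_zero X"
    using dX by (auto simp: point_indicator_def C0_zero_def dest: fun_cong[of _ _ d])
  moreover have "point_indicator X d \<in> projections X"
  proof -
    have "point_indicator X d = C0_star X (point_indicator X d)"
      and "point_indicator X d = C0_mult X (point_indicator X d) (point_indicator X d)"
      by (auto simp: point_indicator_def C0_star_def C0_mult_def)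
    with p show ?thesis unfolding projections_def by blast
  qed
  moreover have "q = point_indicator X d"
    if q: "q \<in> projections X" "q \<noteq> C0_zero X" "projection_le X q (point_indicator X d)" for q
  proof -
    have qC: "q \<in> C0 X" and sq: "C0_mult X q q = q"
      using projectionsD[OF q(1)] by simp_all
    have le: "C0_mult X q (point_indicator X d) = q"
      using q(3) by (simp add: projection_le_def)
    have off: "q x = 0" if "x \<in> topspace X" "x \<noteq> d" for x
      using that fun_cong[OF le, of x] by (simp add: C0_mult_def point_indicator_def)
    have "q d \<noteq> 0"
      using nonzero_in_C0[OF qC q(2)] off by metis
    moreover have "q d * q d = q d"
      using fun_cong[OF sq, of d] dX by (simp add: C0_mult_def)
    ultimately have "q d = 1" by simp
    with off show ?thesis
      by (intro C0_eqI[OF qC p]) (simp add: point_indicator_def)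
  qed
  ultimately show ?thesis
    using J by (auto simp: minimal_projections_def)
qed

text \<open>The restriction of g to a finite subset of S is a linear combination of indicators. Such
  restrictions approximate g uniformly, because g is at least \<epsilon> in modulus only at finitely
  many points. Only the linear structure and closedness of A enter, so this serves ideals and
  subalgebras alike.\<close>

lemma vanishing_ideal_subset:
  assumes A: "C0_subspace X A" "uniformly_closed X A"
    and S: "S \<subseteq> isolated_points X" "\<And>d. d \<in> S \<Longrightarrow> point_indicator X d \<in> A"
  shows "vanishing_ideal X S \<subseteq> A"
proof
  fix g assume g: "g \<in> vanishing_ideal X S"
  then have gC: "g \<in> C0 X" by (simp add: vanishing_ideal_def)
  have fin: "(\<lambda>x\<in>topspace X. if x \<in> F then g x else 0) \<in> A" if "finite F" "F \<subseteq> S" for F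
    using that
  proof (induction F rule: finite_induct)
    case empty
    then show ?case using A(1) by (simp add: C0_subspace_def C0_zero_def[symmetric])
  next
    case (insert d F)
    have "(\<lambda>x\<in>topspace X. if x \<in> insert d F then g x else 0) =
      C0_add X (C0_scale X (g d) (point_indicator X d)) (\<lambda>x\<in>topspace X. if x \<in> F then g x else 0)"
      using insert.hyps by (auto simp: C0_ops_def point_indicator_def restrict_def)
    moreover have "point_indicator X d \<in> A"
      and "(\<lambda>x\<in>topspace X. if x \<in> F then g x else 0) \<in> A"
      using insert S(2) by blast+
    ultimately show ?case using A(1) unfolding C0_subspace_def by metis
  qed
  have "\<exists>a\<in>A. \<forall>x\<in>topspace X. cmod (g x - a x) \<le> \<epsilon>" if \<epsilon>: "\<epsilon> > 0" for \<epsilon>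
  proof -
    define F where "F = {x \<in> topspace X. g x \<in> {z. \<epsilon> \<le> cmod z}}"
    have FS: "F \<subseteq> S"
      using g \<epsilon> by (force simp: F_def vanishing_ideal_def)
    obtain K where K: "compactin X K" "\<forall>x \<in> topspace X - K. cmod (g x) < \<epsilon>"
      using C0D(3)[OF gC \<epsilon>] by blast
    have "F \<subseteq> K" using K(2) by (force simp: F_def)
    moreover have "closedin X F"
      unfolding F_def using C0D(2)[OF gC]
      by (rule closedin_continuous_map_preimage)
        (simp add: closed_Collect_le continuous_on_norm)
    ultimately have "compactin X F" using K(1) closed_compactin by blast
    then have "\<forall>\<U>. (\<forall>U \<in> \<U>. openin X U) \<and> F \<subseteq> \<Union>\<U>
          \<longrightarrow> (\<exists>\<F>. finite \<F> \<and> \<F> \<subseteq> \<U> \<and> F \<subseteq> \<Union>\<F>)"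
      by (simp add: compactin_def)
    \<comment> \<open>The compact set \<open>F\<close> is covered by its own open singletons; a
      finite subcover makes it finite.\<close>
    moreover have "\<forall>U \<in> (\<lambda>x. {x}) ` F. openin X U"
      using FS S(1) by (auto simp: isolated_points_def)
    ultimately obtain \<F> where \<F>: "finite \<F>" "\<F> \<subseteq> (\<lambda>x. {x}) ` F" "F \<subseteq> \<Union>\<F>"
      by (metis UN_singleton order_refl)
    have "finite (\<Union>\<F>)" using \<F>(1,2) by (intro finite_Union) auto
    with \<F>(3) have "finite F" by (rule finite_subset)
    then have "(\<lambda>x\<in>topspace X. if x \<in> F then g x else 0) \<in> A" using FS by (rule fin)
    then show ?thesis
      using \<epsilon> by (intro bexI) (auto simp: F_def)
  qed
  moreover have "A \<subseteq> C0 X" using A(1) by (simp add: C0_subspace_def)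
  ultimately show "g \<in> A" using A(2) gC by (simp add: uniformly_closed_iff)
qed

section \<open>The essential ideals generated by their minimal projections\<close>

text \<open>Complete regularity is applied to U intersected with an open neighbourhood V of x inside
  a compact K. The resulting function vanishes off K, hence at infinity.\<close>

lemma C0_Urysohn:
  assumes X: "locally_compact_space X" "Hausdorff_space X" and U: "openin X U" "x \<in> U"
  obtains f where "f \<in> C0 X" "f x = 1" "\<And>y. y \<in> topspace X - U \<Longrightarrow> f y = 0"
proof -
  have "completely_regular_space X"
    using X by (simp add: locally_compact_regular_imp_completely_regular_space)
  have xX: "x \<in> topspace X" using U openin_subset by blast
  then obtain V K where V: "openin X V" "compactin X K" "x \<in> V" "V \<subseteq> K"
    using X(1) unfolding locally_compact_space_def by blast
  have "openin X (U \<inter> V)" "x \<in> U \<inter> V" using U V by auto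
  with \<open>completely_regular_space X\<close> obtain h where h: "continuous_map X euclideanreal h" "h x = 1"
      "h ` (topspace X - U \<inter> V) \<subseteq> {0}"
    using completely_regular_space_gen_alt'[of "1::real" 0 X] by (metis zero_neq_one)
  have 0: "complex_of_real (h y) = 0" if "y \<in> topspace X - U \<inter> V" for y
    using h(3) that by auto
  have "(\<lambda>y\<in>topspace X. complex_of_real (h y)) \<in> C0 X"
  proof (rule C0_restrictI)
    show "continuous_map X euclidean (\<lambda>y. complex_of_real (h y))"
      using continuous_map_compose[OF h(1), of euclidean complex_of_real]
      by (simp add: o_def continuous_on_of_real)
    show "\<exists>K. compactin X K \<and> (\<forall>y \<in> topspace X - K. cmod (complex_of_real (h y)) < \<epsilon>)"
      if "\<epsilon> > 0" for \<epsilon> :: real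
      using that V(2,4) 0 by (intro exI[of _ K]) (metis Diff_iff IntD2 norm_zero subsetD)
  qed
  then show thesis
    using that[of "\<lambda>y\<in>topspace X. complex_of_real (h y)"] xX h(2) 0 by auto
qed

lemma vanishing_isolated_in_Id_gmp_ess:
  assumes X: "Hausdorff_space X" and dense: "X closure_of isolated_points X = topspace X"
  shows "vanishing_ideal X (isolated_points X) \<in> Id_gmp_ess X"
proof -
  let ?J = "vanishing_ideal X (isolated_points X)"
  have ind: "point_indicator X d \<in> ?J" if "d \<in> isolated_points X" for d
    using point_indicator_in_C0[OF X that] that by (auto simp: vanishing_ideal_def point_indicator_def)
  have "essential_ideal X ?J"
    unfolding essential_ideal_def
  proof (intro allI impI notI)
    fix K assume K: "closed_ideal X K \<and> K \<noteq> {C0_zero X}" and triv: "?J \<inter> K = {C0_zero X}"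
    then obtain k where k: "k \<in> K" "k \<noteq> C0_zero X"
      by (auto simp: closed_ideal_def C0_subspace_def)
    have kC: "k \<in> C0 X" using K k by (auto simp: closed_ideal_def C0_subspace_def)
    obtain x where x: "x \<in> topspace X" "k x \<noteq> 0"
      using nonzero_in_C0[OF kC k(2)] .
    have "openin X {y \<in> topspace X. k y \<in> - {0}}"
      using C0D(2)[OF kC] by (rule openin_continuous_map_preimage) (simp add: open_Compl)
    moreover have "x \<in> {y \<in> topspace X. k y \<in> - {0}}" using x by simp
    \<comment> \<open>Density yields an isolated point where k is nonzero; multiplying k by its
      indicator gives a nonzero common element of \<open>K\<close> and \<open>?J\<close>.\<close>
    ultimately have "isolated_points X \<inter> {y \<in> topspace X. k y \<in> - {0}} \<noteq> {}"
      using dense unfolding dense_intersects_open by blast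
    then obtain d where d: "d \<in> isolated_points X" "d \<in> topspace X" "k d \<noteq> 0" by blast
    have "C0_mult X (point_indicator X d) k \<in> K"
      using K k(1) point_indicator_in_C0[OF X d(1)] by (simp add: closed_ideal_def)
    moreover have "C0_mult X (point_indicator X d) k \<in> ?J"
      using C0_mult_in_C0[OF point_indicator_in_C0[OF X d(1)] kC] d
      by (auto simp: vanishing_ideal_def C0_mult_def point_indicator_def)
    ultimately have "C0_mult X (point_indicator X d) k = C0_zero X" using triv by blast
    from fun_cong[OF this, of d] d show False
      by (simp add: C0_ops_def point_indicator_def)
  qed
  moreover have "generated_by_minimal_projections X ?J"
    unfolding generated_by_minimal_projections_def
  proof (rule hull_unique[symmetric])
    show "minimal_projections X ?J \<subseteq> ?J" by (auto simp: minimal_projections_def)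
    \<comment> \<open>All indicators of isolated points are minimal projections of
      \<open>?J\<close>, so A contains them and therefore their closed span.\<close>
    show "?J \<subseteq> A" if "minimal_projections X ?J \<subseteq> A" "cstar_subalgebra X A" for A
      using that ind point_indicator_minimal_projection[OF X]
      by (intro vanishing_ideal_subset) (auto simp: cstar_subalgebra_def)
  qed (rule vanishing_ideal_cstar_subalgebra)
  ultimately show ?thesis
    by (simp add: Id_gmp_ess_def vanishing_ideal_closed_ideal)
qed

section \<open>Minimal projections of an ideal\<close>

lemma C0_mult_projections:
  assumes "p \<in> projections X" "q \<in> projections X"
  shows "C0_mult X p q \<in> projections X"
proof -
  let ?r = "C0_mult X p q"
  note pq = projectionsD[OF assms(1)] projectionsD[OF assms(2)]
  have "C0_star X ?r = C0_mult X (C0_star X p) (C0_star X q)"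
    and "C0_mult X ?r ?r = C0_mult X (C0_mult X p p) (C0_mult X q q)"
    by (auto simp: C0_star_def C0_mult_def fun_eq_iff)
  with pq C0_mult_in_C0[of p X q] show ?thesis
    by (simp add: projections_def)
qed

text \<open>The product is a nonzero projection of J below both factors, so minimality makes it
  equal to each of them.\<close>

lemma minimal_projection_mult:
  assumes J: "closed_ideal X J" and p: "p \<in> minimal_projections X J"
    and q: "q \<in> minimal_projections X J" and nz: "C0_mult X q p \<noteq> C0_zero X"
  shows "p = q"
proof -
  have pq: "p \<in> projections X" "p \<in> J" "q \<in> projections X" "q \<in> J"
    using minimal_projectionsD[OF p] minimal_projectionsD[OF q] by simp_all
  note idem = projectionsD(3)[OF pq(1)] projectionsD(3)[OF pq(3)]
  have r: "C0_mult X q p \<in> projections X \<inter> J"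
    using J pq(2) C0_mult_projections[OF pq(3,1)] projectionsD(1)[OF pq(3)]
    by (simp add: closed_ideal_def)
  have "C0_mult X (C0_mult X q p) p = C0_mult X q (C0_mult X p p)"
    and "C0_mult X (C0_mult X q p) q = C0_mult X (C0_mult X q q) p"
    by (auto simp: C0_mult_def fun_eq_iff)
  then have "projection_le X (C0_mult X q p) p" "projection_le X (C0_mult X q p) q"
    using idem by (auto simp: projection_le_def)
  then have "C0_mult X q p = p" "C0_mult X q p = q"
    using p q r nz unfolding minimal_projections_def by blast+
  then show ?thesis by simp
qed

lemma minimal_projection_is_point_indicator:
  assumes X: "locally_compact_space X" "Hausdorff_space X"
    and J: "closed_ideal X J" and gen: "generated_by_minimal_projections X J"
    and p: "p \<in> minimal_projections X J"
  obtains d where "d \<in> isolated_points X" "p = point_indicator X d"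
proof -
  have pJ: "p \<in> J" and pC: "p \<in> C0 X" and nz: "p \<noteq> C0_zero X"
    using minimal_projectionsD[OF p] projectionsD(1) by simp_all
  have 01: "q x = 0 \<or> q x = 1" if "q \<in> minimal_projections X J" "x \<in> topspace X" for q x
  proof -
    have "q x * q x = q x"
      using fun_cong[OF projectionsD(3)[OF minimal_projectionsD(1)[OF that(1)]], of x] that(2)
      by (simp add: C0_mult_def)
    then show ?thesis by auto
  qed
  obtain d where d: "d \<in> topspace X" "p d = 1"
    using nonzero_in_C0[OF pC nz] 01[OF p] by metis
  have off: "p y = 0" if y: "y \<in> topspace X" "y \<noteq> d" for y
  proof (rule ccontr)
    assume "p y \<noteq> 0"
    then have py: "p y = 1" using 01[OF p y(1)] by simp
    have "minimal_projections X J \<subseteq> {f \<in> C0 X. f d = f y}"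
    proof
      fix q assume q: "q \<in> minimal_projections X J"
      have "q d = q y"
      \<comment> \<open>As p is 1 at both points, a q orthogonal to p vanishes at both; any other q
        is p itself.\<close>
      proof (cases "C0_mult X q p = C0_zero X")
        case True
        show ?thesis
          using fun_cong[OF True, of d] fun_cong[OF True, of y] d y py
          by (simp add: C0_mult_def C0_zero_def)
      next
        case False
        then show ?thesis using minimal_projection_mult[OF J p q] d py by simp
      qed
      with projectionsD(1)[OF minimal_projectionsD(1)[OF q]] show "q \<in> {f \<in> C0 X. f d = f y}"
        by simp
    qed
    then have const: "J \<subseteq> {f \<in> C0 X. f d = f y}"
      using gen equalizer_cstar_subalgebra[OF d(1) y(1)]
      unfolding generated_by_minimal_projections_def by (metis hull_minimal)
    \<comment> \<open>A function f separating d from y contradicts constancy: its product with p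
      lies in J but takes the values 1 at d and 0 at y.\<close>
    have "openin X (topspace X - {y})"
      using y X(2) by (simp add: closedin_Hausdorff_sing_eq openin_diff)
    with d y obtain f where f: "f \<in> C0 X" "f d = 1" "f y = 0"
      using C0_Urysohn[OF X, of "topspace X - {y}" d] by blast
    have "C0_mult X f p \<in> J" using J f(1) pJ by (simp add: closed_ideal_def)
    then have "C0_mult X f p d = C0_mult X f p y" using const by blast
    with d y py f show False by (simp add: C0_mult_def)
  qed
  \<comment> \<open>The set where p is nonzero is open by continuity, and it has just been shown to
    be \<open>{d}\<close>; hence d is isolated.\<close>
  have "openin X {x \<in> topspace X. p x \<in> - {0}}"
    using C0D(2)[OF pC] by (rule openin_continuous_map_preimage) (simp add: open_Compl)
  moreover have "{x \<in> topspace X. p x \<in> - {0}} = {d}"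
    using off d by auto
  ultimately have iso: "d \<in> isolated_points X" by (simp add: isolated_points_def)
  moreover have "p = point_indicator X d"
    using off d by (intro C0_eqI[OF pC point_indicator_in_C0[OF X(2) iso]])
      (auto simp: point_indicator_def)
  ultimately show thesis by (rule that)
qed

text \<open>Essentiality is applied to the ideal of functions vanishing off U, which is nonzero by
  Urysohn's lemma.\<close>

lemma essential_ideal_meets_vanishing_ideal:
  assumes X: "locally_compact_space X" "Hausdorff_space X"
    and J: "closed_ideal X J" "essential_ideal X J" and U: "openin X U" "U \<noteq> {}"
  obtains h x where "h \<in> J" "h \<in> vanishing_ideal X U" "x \<in> U" "h x \<noteq> 0"
proof -
  obtain u where u: "u \<in> U" "u \<in> topspace X" using U openin_subset by blast
  obtain f where f: "f \<in> C0 X" "f u = 1" "\<And>y. y \<in> topspace X - U \<Longrightarrow> f y = 0"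
    using C0_Urysohn[OF X U(1) u(1)] by blast
  then have "f \<in> vanishing_ideal X U" by (simp add: vanishing_ideal_def)
  moreover have "f \<noteq> C0_zero X"
    using f(2) u by (auto simp: C0_zero_def)
  ultimately have "J \<inter> vanishing_ideal X U \<noteq> {C0_zero X}"
    using J(2) vanishing_ideal_closed_ideal[of X U] unfolding essential_ideal_def by blast
  \<comment> \<open>Rules out that the intersection differs from the zero ideal merely by being
    empty.\<close>
  moreover have "C0_zero X \<in> J \<inter> vanishing_ideal X U"
    using J(1) vanishing_ideal_closed_ideal[of X U] by (simp add: closed_ideal_def C0_subspace_def)
  ultimately obtain h where h: "h \<in> J" "h \<in> vanishing_ideal X U" "h \<noteq> C0_zero X" by blast
  have hC: "h \<in> C0 X" using h(2) by (simp add: vanishing_ideal_def)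
  obtain x where "x \<in> topspace X" "h x \<noteq> 0"
    using nonzero_in_C0[OF hC h(3)] .
  moreover from this have "x \<in> U" using h(2) by (auto simp: vanishing_ideal_def)
  ultimately show thesis using h that by blast
qed

lemma Id_gmp_ess_unique:
  assumes X: "locally_compact_space X" "Hausdorff_space X" and J: "J \<in> Id_gmp_ess X"
  shows "J = vanishing_ideal X (isolated_points X)"
    and "X closure_of isolated_points X = topspace X"
proof -
  let ?D = "isolated_points X"
  have ci: "closed_ideal X J" and ess: "essential_ideal X J"
    and gen: "generated_by_minimal_projections X J"
    using J by (auto simp: Id_gmp_ess_def)
  have "minimal_projections X J \<subseteq> vanishing_ideal X ?D"
  proof
    fix p assume "p \<in> minimal_projections X J"
    then obtain d where d: "d \<in> ?D" "p = point_indicator X d"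
      using minimal_projection_is_point_indicator[OF X ci gen] by blast
    then show "p \<in> vanishing_ideal X ?D"
      using point_indicator_in_C0[OF X(2)] by (auto simp: vanishing_ideal_def point_indicator_def)
  qed
  then have sub: "J \<subseteq> vanishing_ideal X ?D"
    using gen vanishing_ideal_cstar_subalgebra unfolding generated_by_minimal_projections_def
    by (metis hull_minimal)
  have ind: "point_indicator X d \<in> J" if d: "d \<in> ?D" for d
  proof -
    have "openin X {d}" using d by (simp add: isolated_points_def)
    then obtain h where h: "h \<in> J" "h \<in> vanishing_ideal X {d}" "h d \<noteq> 0"
      using essential_ideal_meets_vanishing_ideal[OF X ci ess, of "{d}"] by blast
    \<comment> \<open>An element supported on one point is a multiple of its indicator; dividing by
      the value at d normalises it.\<close>
    have "point_indicator X d = C0_scale X (1 / h d) h"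
      using h by (auto simp: point_indicator_def C0_scale_def vanishing_ideal_def fun_eq_iff)
    with h(1) ci show ?thesis by (simp add: closed_ideal_def C0_subspace_def)
  qed
  have "vanishing_ideal X ?D \<subseteq> J"
    using ci ind by (intro vanishing_ideal_subset) (auto simp: closed_ideal_def)
  with sub show "J = vanishing_ideal X ?D" by blast
  have "\<exists>d\<in>?D. d \<in> U" if U: "openin X U" "U \<noteq> {}" for U
  proof -
    obtain h x where h: "h \<in> J" "x \<in> U" "h x \<noteq> 0"
      using essential_ideal_meets_vanishing_ideal[OF X ci ess U] by blast
    \<comment> \<open>Elements of J vanish off the isolated points, so a point of U where h is
      nonzero is isolated.\<close>
    then have "x \<in> ?D" using sub openin_subset[OF U(1)] by (auto simp: vanishing_ideal_def)
    with h(2) show ?thesis by blast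
  qed
  then show "X closure_of ?D = topspace X"
    unfolding dense_intersects_open by blast
qed

section \<open>Discretizations\<close>

text \<open>Discreteness gives an open U meeting the range only in s. Then U without s is open and
  misses a dense set, so it is empty and s is isolated. Conversely, a dense set meets every open
  singleton.\<close>

lemma discretization_range:
  assumes X: "Hausdorff_space X" and fY: "(f, Y) \<in> discretizations X"
  shows "f ` topspace Y = isolated_points X"
proof -
  let ?S = "f ` topspace Y"
  have Y: "Y = discrete_topology (topspace Y)" and emb: "homeomorphic_map Y (subtopology X ?S) f"
    and dense: "X closure_of ?S = topspace X"
    using fY by (auto simp: discretizations_def embedding_map_def)
  show ?thesis
  proof (intro equalityI subsetI)
    fix s assume s: "s \<in> ?S"
    then obtain y where y: "y \<in> topspace Y" "s = f y" by blast
    have "openin Y {y}" using y Y by (metis empty_subsetI insert_subset openin_discrete_topology)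
    then have "openin (subtopology X ?S) {s}"
      using homeomorphic_imp_open_map[OF emb] y unfolding open_map_def by fastforce
    then obtain U where U: "openin X U" "{s} = U \<inter> ?S"
      by (auto simp: openin_subtopology)
    have sX: "s \<in> topspace X" using U openin_subset by blast
    have "closedin X {s}" using sX X by (simp add: closedin_Hausdorff_sing_eq)
    with U(1) have "openin X (U - {s})" by (rule openin_diff)
    then have "U - {s} = {}"
      using dense U(2) unfolding dense_intersects_open by blast
    moreover have "s \<in> U" using U(2) by blast
    ultimately have "U = {s}" by blast
    with U(1) show "s \<in> isolated_points X" by (simp add: isolated_points_def)
  next
    fix d assume "d \<in> isolated_points X"
    then show "d \<in> ?S"
      using dense unfolding dense_intersects_open isolated_points_def by fastforce
  qed
qed

text \<open>Both embeddings are bijections onto the isolated points, so the inverse of g composed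
  with f is the required bijection.\<close>

lemma discretizations_equiv:
  assumes X: "Hausdorff_space X" and fY: "(f, Y) \<in> discretizations X"
    and gZ: "(g, Z) \<in> discretizations X"
  shows "discretization_equiv (f, Y) (g, Z)"
proof -
  have bij: "bij_betw f (topspace Y) (isolated_points X)" "bij_betw g (topspace Z) (isolated_points X)"
    using discretization_range[OF X fY] discretization_range[OF X gZ] fY gZ
    by (auto simp: discretizations_def embedding_map_def homeomorphic_eq_everything_map bij_betw_def)
  have "bij_betw (inv_into (topspace Z) g \<circ> f) (topspace Y) (topspace Z)"
    using bij by (blast intro: bij_betw_trans bij_betw_inv_into)
  moreover have "g ((inv_into (topspace Z) g \<circ> f) y) = f y" if "y \<in> topspace Y" for y
    using bij that by (simp add: bij_betw_inv_into_right bij_betwE)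
  ultimately show ?thesis
    unfolding discretization_equiv_def by blast
qed

lemma discretization_ideal_eq:
  assumes "Hausdorff_space X" "e \<in> discretizations X"
  shows "discretization_ideal X e = vanishing_ideal X (isolated_points X)"
proof (cases e)
  case (Pair f Y)
  with assms discretization_range[of X f Y] show ?thesis
    by (simp add: discretization_ideal_def vanishing_ideal_def)
qed

lemma isolated_points_discretization:
  assumes "X closure_of isolated_points X = topspace X"
  shows "(id, discrete_topology (isolated_points X)) \<in> discretizations X"
proof -
  have "subtopology X (isolated_points X) = discrete_topology (isolated_points X)"
    using isolated_points_subset[of X]
    by (auto simp: subtopology_eq_discrete_topology_eq derived_set_of_def isolated_points_def)
  then have "embedding_map (discrete_topology (isolated_points X)) X id"
    by (simp add: embedding_map_def)
  with assms show ?thesis by (simp add: discretizations_def)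
qed

text \<open>The inclusion of the isolated points has its domain in \<open>'a\<close>; the
  cardinality assumption moves it to an equivalent discretization on \<open>'b\<close>.\<close>

lemma discretizations_nonempty_iff:
  fixes X :: "'a topology"
  assumes "Hausdorff_space X" and "topspace X \<lesssim> (UNIV :: 'b set)"
  shows "(discretizations X :: (('b \<Rightarrow> 'a) \<times> 'b topology) set) \<noteq> {} \<longleftrightarrow>
    X closure_of isolated_points X = topspace X"
proof
  assume "X closure_of isolated_points X = topspace X"
  then show "(discretizations X :: (('b \<Rightarrow> 'a) \<times> 'b topology) set) \<noteq> {}"
    using ex_equivalent_discretization[OF assms(2) isolated_points_discretization] by blast
next
  assume "(discretizations X :: (('b \<Rightarrow> 'a) \<times> 'b topology) set) \<noteq> {}"
  then obtain f :: "'b \<Rightarrow> 'a" and Y where fY: "(f, Y) \<in> discretizations X" by auto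
  then show "X closure_of isolated_points X = topspace X"
    using discretization_range[OF assms(1) fY] by (simp add: discretizations_def)
qed

theorem proposition7p5:
  fixes X :: "'a topology"
  assumes "locally_compact_space X" and "Hausdorff_space X"
    and "topspace X \<lesssim> (UNIV :: 'b set)"
  shows "(discretization_ideal X :: ('b \<Rightarrow> 'a) \<times> 'b topology \<Rightarrow> ('a \<Rightarrow> complex) set)
           respects discretization_rel X \<and>
         bij_betw (induced_ideal_map X :: (('b \<Rightarrow> 'a) \<times> 'b topology) set \<Rightarrow> ('a \<Rightarrow> complex) set)
           (discretization_classes X) (Id_gmp_ess X)"
proof
  let ?D = "discretizations X :: (('b \<Rightarrow> 'a) \<times> 'b topology) set"
  let ?J = "vanishing_ideal X (isolated_points X)"
  note X = assms(1,2)
  show "(discretization_ideal X :: ('b \<Rightarrow> 'a) \<times> 'b topology \<Rightarrow> ('a \<Rightarrow> complex) set)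
      respects discretization_rel X"
    by (auto simp: congruent_def discretization_rel_def discretization_ideal_eq[OF X(2)])
  show "bij_betw (induced_ideal_map X :: (('b \<Rightarrow> 'a) \<times> 'b topology) set \<Rightarrow> _)
      (discretization_classes X) (Id_gmp_ess X)"
  \<comment> \<open>Classes and ideals are either both absent or exactly one each, so bijectivity
    reduces to comparing two empty sets or two singletons.\<close>
  proof (cases "?D = {}")
    case True
    then have "Id_gmp_ess X = {}"
      using discretizations_nonempty_iff[OF X(2) assms(3)] Id_gmp_ess_unique(2)[OF X] by blast
    with True show ?thesis by (simp add: discretization_classes_def quotient_def bij_betw_def)
  next
    case False
    then have dense: "X closure_of isolated_points X = topspace X"
      using discretizations_nonempty_iff[OF X(2) assms(3)] by blast
    have "Id_gmp_ess X = {?J}"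
      using vanishing_isolated_in_Id_gmp_ess[OF X(2) dense] Id_gmp_ess_unique(1)[OF X] by blast
    \<comment> \<open>Any two discretizations are equivalent, so the quotient is a single
      class.\<close>
    moreover have "discretization_rel X = ?D \<times> ?D"
      using discretizations_equiv[OF X(2)] by (auto simp: discretization_rel_def)
    then have "discretization_classes X = {?D}"
      using False by (auto simp: discretization_classes_def quotient_def)
    moreover have "discretization_ideal X ` ?D = {?J}"
      using False discretization_ideal_eq[OF X(2)] by (auto simp: image_iff)
    then have "induced_ideal_map X ?D = ?J"
      by (simp add: induced_ideal_map_def)
    ultimately show ?thesis by (simp add: bij_betw_def)
  qed
qed

end
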